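(* Any (probabilistic bounded error or deterministic) symbolic algorithm that solves Reachability in directed graphs with diameter $D$ requires $\Omega(D)$ symbolic one-step operations.
   Context: Symbolic model: the input is a finite directed graph $G=(V,E)$ (self-loops allowed), $n=|V|$, together with a starting vertex $s\in V$ and a target set $T\subseteq V$. The algorithm knows $V$, $s$, $T$, but it can access $E$ only through the one-step operations $\mathrm{Pre}(S)=\{v\in V\mid \exists s'\in S:(v,s')\in E\}$ and $\mathrm{Post}(S)=\{v\in V\mid \exists s'\in S:(s',v)\in E\}$ applied to (adaptively chosen) sets $S\subseteq V$. All other computation, in particular basic set operations on vertex sets, is unrestricted and not counted in lower bounds; any number of sets may be stored. A probabilistic bounded error algorithm may use random bits and must be correct with probability at least $2/3$ on every input. Reachability: decide whether there is an infinite path in $G$ starting from $s$ that visits a vertex of $T$ at least once. Convention for lower bounds: "requires $\Omega(D)$ one-step operations" means: there is an absolute constant $c>0$ such that every (deterministic or probabilistic bounded error) symbolic algorithm solving the problem on all inputs performs, on inputs with arbitrarily large $D$, at least $c\cdot D$ one-step operations (worst case over its random choices). The diameter $D$ of $G$ is the largest finite distance: the maximum of $d(u,v)$ over all pairs $u,v$ such that $u$ can reach $v$, where $d(u,v)$ is the smallest number of edges on a path from $u$ to $v$. *)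

theory Defs
  imports "HOL-Probability.Probability"
begin

definition reach_input :: "'v set \<Rightarrow> ('v \<times> 'v) set \<Rightarrow> 'v \<Rightarrow> 'v set \<Rightarrow> bool" where
  "reach_input V E s T \<longleftrightarrow> finite V \<and> E \<subseteq> V \<times> V \<and> s \<in> V \<and> T \<subseteq> V"

definition pre_set :: "'v set \<Rightarrow> ('v \<times> 'v) set \<Rightarrow> 'v set \<Rightarrow> 'v set" where
  "pre_set V E S = {v \<in> V. \<exists>s'\<in>S. (v, s') \<in> E}"

definition post_set :: "'v set \<Rightarrow> ('v \<times> 'v) set \<Rightarrow> 'v set \<Rightarrow> 'v set" where
  "post_set V E S = {v \<in> V. \<exists>s'\<in>S. (s', v) \<in> E}"

definition infinite_path :: "('v \<times> 'v) set \<Rightarrow> (nat \<Rightarrow> 'v) \<Rightarrow> bool" where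
  "infinite_path E p \<longleftrightarrow> (\<forall>i. (p i, p (Suc i)) \<in> E)"

definition reachability :: "('v \<times> 'v) set \<Rightarrow> 'v \<Rightarrow> 'v set \<Rightarrow> bool" where
  "reachability E s T \<longleftrightarrow> (\<exists>p. infinite_path E p \<and> p 0 = s \<and> (\<exists>i. p i \<in> T))"

text \<open>Only meaningful if \<open>v\<close> is reachable from \<open>u\<close>.\<close>

definition distance :: "('v \<times> 'v) set \<Rightarrow> 'v \<Rightarrow> 'v \<Rightarrow> nat" where
  "distance E u v = (LEAST k. (u, v) \<in> E ^^ k)"

definition graph_diameter :: "'v set \<Rightarrow> ('v \<times> 'v) set \<Rightarrow> nat" where
  "graph_diameter V E = Max {distance E u v | u v. u \<in> V \<and> v \<in> V \<and> (u, v) \<in> E\<^sup>*}"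

datatype 'v action = Apply_Pre "'v set" | Apply_Post "'v set" | Toss | Halt bool

datatype 'v reply = Vertices "'v set" | Coin bool

text \<open>
  An algorithm sees \<open>V\<close>, \<open>s\<close> and \<open>T\<close> and chooses its next action from the replies received so far.
  This choice is an arbitrary function: computation other than one-step operations is unrestricted,
  and all sets obtained remain available. Its own earlier actions are determined by the replies.
  Sets passed to the operations need not be contained in \<open>V\<close>; vertices outside \<open>V\<close> have no
  incident edges and do not influence the result.
\<close>

type_synonym 'v strategy = "'v reply list \<Rightarrow> 'v action"

type_synonym 'v symbolic_algorithm = "'v set \<Rightarrow> 'v \<Rightarrow> 'v set \<Rightarrow> 'v strategy"

text \<open>
  The replies received in the first \<open>k\<close> steps. A coin toss in step \<open>k\<close> reads the bit \<open>\<omega> !! k\<close>; the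
  bits belonging to other steps are discarded, so that each toss uses a fresh bit.
\<close>

primrec history ::
  "'v set \<Rightarrow> ('v \<times> 'v) set \<Rightarrow> 'v strategy \<Rightarrow> bool stream \<Rightarrow> nat \<Rightarrow> 'v reply list" where
  "history V E \<sigma> \<omega> 0 = []"
| "history V E \<sigma> \<omega> (Suc k) =
    (let h = history V E \<sigma> \<omega> k in
     case \<sigma> h of
       Apply_Pre S \<Rightarrow> h @ [Vertices (pre_set V E S)]
     | Apply_Post S \<Rightarrow> h @ [Vertices (post_set V E S)]
     | Toss \<Rightarrow> h @ [Coin (\<omega> !! k)]
     | Halt b \<Rightarrow> h)"

definition outputs ::
  "'v set \<Rightarrow> ('v \<times> 'v) set \<Rightarrow> 'v strategy \<Rightarrow> bool stream \<Rightarrow> bool \<Rightarrow> bool" where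
  "outputs V E \<sigma> \<omega> b \<longleftrightarrow> (\<exists>k. \<sigma> (history V E \<sigma> \<omega> k) = Halt b)"

definition one_step_ops :: "'v reply list \<Rightarrow> nat" where
  "one_step_ops h = length (filter (\<lambda>r. \<exists>S. r = Vertices S) h)"

text \<open>Infinite if the number of operations is unbounded.\<close>

definition worst_case_ops :: "'v set \<Rightarrow> ('v \<times> 'v) set \<Rightarrow> 'v strategy \<Rightarrow> enat" where
  "worst_case_ops V E \<sigma> = (SUP \<omega>. SUP k. enat (one_step_ops (history V E \<sigma> \<omega> k)))"

definition coin_space :: "bool stream measure" where
  "coin_space = stream_space (measure_pmf (bernoulli_pmf (1/2)))"

definition deterministic :: "'v symbolic_algorithm \<Rightarrow> bool" where
  "deterministic A \<longleftrightarrow> (\<forall>V s T h. A V s T h \<noteq> Toss)"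

definition solves_reachability :: "'v symbolic_algorithm \<Rightarrow> bool" where
  "solves_reachability A \<longleftrightarrow>
    (\<forall>V E s T. reach_input V E s T \<longrightarrow>
      (\<forall>\<omega>. outputs V E (A V s T) \<omega> (reachability E s T)))"

definition solves_reachability_bounded_error :: "'v symbolic_algorithm \<Rightarrow> bool" where
  "solves_reachability_bounded_error A \<longleftrightarrow>
    (\<forall>V E s T. reach_input V E s T \<longrightarrow>
      \<P>(\<omega> in coin_space. outputs V E (A V s T) \<omega> (reachability E s T)) \<ge> 2/3)"

end

theory Submission imports Defs begin

text \<open>
  On the vertices \<open>0, \<dots>, n\<close> consider the graph with all edges \<open>(a, b)\<close> where \<open>b \<le> a + 1\<close>. It has
  diameter \<open>n\<close>, and \<open>n\<close> is reachable from \<open>0\<close>, but no longer so after deleting any one of the \<open>n\<close>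
  edges \<open>(i, i + 1)\<close>. Because of the backward edges, the deletion of \<open>(i, i + 1)\<close> changes
  \<open>Post(S)\<close> only if \<open>i\<close> is the maximum of \<open>S\<close>, and \<open>Pre(S)\<close> only if \<open>i + 1\<close> is the minimum of
  \<open>S\<close>, so each operation on the full graph rules out at most one deletion. An algorithm with
  success probability \<open>2/3\<close> must, for each \<open>i\<close>, answer correctly on both graphs with probability
  at least \<open>1/3\<close>, which requires that a run on the full graph tests \<open>i\<close>. By linearity of
  expectation some run on the full graph uses at least \<open>n/3\<close> operations.
\<close>

section \<open>Comparing runs on two graphs\<close>

text \<open>\<open>Toss\<close> never distinguishes: runs on both graphs are compared under the same
  \<open>\<omega>\<close>, so a toss in the same step gets the same bit.\<close>

fun distinguishes :: "'v set \<Rightarrow> ('v \<times> 'v) set \<Rightarrow> ('v \<times> 'v) set \<Rightarrow> 'v action \<Rightarrow> bool" where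
  "distinguishes V E E' (Apply_Pre S) \<longleftrightarrow> pre_set V E S \<noteq> pre_set V E' S"
| "distinguishes V E E' (Apply_Post S) \<longleftrightarrow> post_set V E S \<noteq> post_set V E' S"
| "distinguishes V E E' _ \<longleftrightarrow> False"

lemma history_Suc_cong:
  assumes "history V E' \<sigma> \<omega> k = history V E \<sigma> \<omega> k"
    and "\<not> distinguishes V E E' (\<sigma> (history V E \<sigma> \<omega> k))"
  shows "history V E' \<sigma> \<omega> (Suc k) = history V E \<sigma> \<omega> (Suc k)"
  using assms by (cases "\<sigma> (history V E \<sigma> \<omega> k)") (auto simp: Let_def)

lemma one_step_ops_history_Suc:
  "one_step_ops (history V E \<sigma> \<omega> (Suc k)) = one_step_ops (history V E \<sigma> \<omega> k) +
    (case \<sigma> (history V E \<sigma> \<omega> k) of Apply_Pre S \<Rightarrow> 1 | Apply_Post S \<Rightarrow> 1 | _ \<Rightarrow> 0)"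
  by (auto simp: Let_def one_step_ops_def split: action.splits)

text \<open>The run on \<open>E\<close> is the fixed reference. As long as the run on
  \<open>E' i\<close> agrees with it, both take the same next action, so \<open>i\<close> can join
  the deviating indices only when that action distinguishes \<open>E\<close> from
  \<open>E' i\<close>.\<close>

lemma card_distinguished_le_one_step_ops:
  assumes fin: "finite I"
    and one: "\<And>a. card {i \<in> I. distinguishes V E (E' i) a} \<le> 1"
  shows "card {i \<in> I. history V (E' i) \<sigma> \<omega> k \<noteq> history V E \<sigma> \<omega> k}
    \<le> one_step_ops (history V E \<sigma> \<omega> k)"
proof (induction k)
  case 0
  then show ?case by simp
next
  case (Suc k)
  define a where "a = \<sigma> (history V E \<sigma> \<omega> k)"
  define X where "X k = {i \<in> I. history V (E' i) \<sigma> \<omega> k \<noteq> history V E \<sigma> \<omega> k}" for k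
  define Y where "Y = {i \<in> I. distinguishes V E (E' i) a}"
  have "X (Suc k) \<subseteq> X k \<union> Y"
    using history_Suc_cong[of V _ \<sigma> \<omega> k E] by (fastforce simp only: X_def Y_def a_def)
  then have "card (X (Suc k)) \<le> card (X k \<union> Y)"
    by (rule card_mono[rotated]) (use fin in \<open>auto simp: X_def Y_def\<close>)
  also have "\<dots> \<le> card (X k) + card Y"
    by (rule card_Un_le)
  also have "\<dots> \<le> one_step_ops (history V E \<sigma> \<omega> k) + card Y"
    using Suc unfolding X_def by simp
  \<comment> \<open>A one-step operation pays for the at most one index in \<open>Y\<close>; for
    \<open>Toss\<close> and \<open>Halt\<close> the set \<open>Y\<close> is empty.\<close>
  also have "\<dots> \<le> one_step_ops (history V E \<sigma> \<omega> (Suc k))"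
    using one[of a] unfolding one_step_ops_history_Suc Y_def a_def[symmetric] by (cases a) auto
  finally show ?case unfolding X_def .
qed

lemma history_halted:
  assumes "\<sigma> (history V E \<sigma> \<omega> k) = Halt b" "k \<le> l"
  shows "history V E \<sigma> \<omega> l = history V E \<sigma> \<omega> k"
  using assms(2) by (induction l rule: dec_induct) (auto simp: assms(1) Let_def)

lemma outputs_unique:
  assumes "outputs V E \<sigma> \<omega> b" "outputs V E \<sigma> \<omega> b'"
  shows "b = b'"
proof -
  obtain k k' where k: "\<sigma> (history V E \<sigma> \<omega> k) = Halt b" and k': "\<sigma> (history V E \<sigma> \<omega> k') = Halt b'"
    using assms by (auto simp: outputs_def)
  show ?thesis
  proof (cases "k \<le> k'")
    case True
    then show ?thesis
      using k k' history_halted[of \<sigma> V E \<omega>, OF k True] by simp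
  next
    case False
    then have "k' \<le> k" by simp
    then show ?thesis
      using k k' history_halted[of \<sigma> V E \<omega>, OF k' \<open>k' \<le> k\<close>] by simp
  qed
qed

lemma one_step_ops_le_worst_case_ops:
  "enat (one_step_ops (history V E \<sigma> \<omega> k)) \<le> worst_case_ops V E \<sigma>"
  unfolding worst_case_ops_def by (rule SUP_upper2[of \<omega>], simp, rule SUP_upper, simp)

section \<open>From success probabilities to an operation count\<close>

lemma prob_space_coin_space: "prob_space coin_space"
  unfolding coin_space_def by (intro prob_space.prob_space_stream_space measure_pmf.prob_space_axioms)

lemma space_coin_space [simp]: "space coin_space = UNIV"
  by (simp add: coin_space_def space_stream_space)

text \<open>Success on every coin sequence makes the event the whole space, of probability 1. This
  reduces the first alternative of the theorem to the second.\<close>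

lemma solves_imp_solves_bounded_error:
  assumes "solves_reachability A"
  shows "solves_reachability_bounded_error A"
proof -
  interpret prob_space coin_space by (rule prob_space_coin_space)
  show ?thesis
    using assms prob_space by (simp add: solves_reachability_def solves_reachability_bounded_error_def)
qed

lemma (in prob_space) prob_Int_ge:
  assumes "A \<in> events" "B \<in> events"
  shows "prob A + prob B - 1 \<le> prob (A \<inter> B)"
proof -
  have "prob (A \<union> B) = prob A + prob B - prob (A \<inter> B)"
    using assms by (simp add: measure_Un3 fmeasurable_eq_sets)
  then show ?thesis
    using prob_le_1[of "A \<union> B"] by linarith
qed

lemma card_indistinguishable_le_worst_case_ops:
  assumes fin: "finite I"
    and one: "\<And>a. card {i \<in> I. distinguishes V E (E' i) a} \<le> 1"
    and E: "\<P>(\<omega> in coin_space. outputs V E \<sigma> \<omega> b) \<ge> 2/3"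
    and E': "\<And>i. i \<in> I \<Longrightarrow> \<P>(\<omega> in coin_space. outputs V (E' i) \<sigma> \<omega> (\<not> b)) \<ge> 2/3"
  shows "ereal (1/3 * real (card I)) \<le> ereal_of_enat (worst_case_ops V E \<sigma>)"
proof (cases "worst_case_ops V E \<sigma>")
  case infinity
  then show ?thesis by simp
next
  case (enat q)
  interpret prob_space coin_space by (rule prob_space_coin_space)
  define G where "G = {\<omega>. outputs V E \<sigma> \<omega> b}"
  define H where "H i = {\<omega>. outputs V (E' i) \<sigma> \<omega> (\<not> b)}" for i
  have G: "prob G \<ge> 2/3" and H: "prob (H i) \<ge> 2/3" if "i \<in> I" for i
    using E E'[OF that] by (simp_all add: G_def H_def)
  \<comment> \<open>A set that is not measurable would have measure \<open>0\<close>.\<close>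
  have events: "G \<in> events" "H i \<in> events" if "i \<in> I" for i
    using G[OF that] H[OF that] measure_notin_sets by fastforce+
  have ge: "1/3 \<le> prob (G \<inter> H i)" if "i \<in> I" for i
    using prob_Int_ge[OF events[OF that]] G[OF that] H[OF that] by simp
  have pointwise: "(\<Sum>i\<in>I. indicator (G \<inter> H i) \<omega>) \<le> real q" for \<omega>
  proof (cases "\<omega> \<in> G")
    case True
    then obtain k where k: "\<sigma> (history V E \<sigma> \<omega> k) = Halt b"
      by (auto simp: G_def outputs_def)
    \<comment> \<open>With equal histories at step \<open>k\<close>, the run on \<open>E' i\<close>
      would halt with \<open>b\<close> as well, against \<open>\<omega> \<in> H i\<close>.\<close>
    have "history V (E' i) \<sigma> \<omega> k \<noteq> history V E \<sigma> \<omega> k" if "\<omega> \<in> H i" for i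
    proof
      assume "history V (E' i) \<sigma> \<omega> k = history V E \<sigma> \<omega> k"
      then have "outputs V (E' i) \<sigma> \<omega> b" using k unfolding outputs_def by metis
      then show False using that outputs_unique unfolding H_def by blast
    qed
    then have "card {i \<in> I. \<omega> \<in> H i} \<le> card {i \<in> I. history V (E' i) \<sigma> \<omega> k \<noteq> history V E \<sigma> \<omega> k}"
      by (intro card_mono) (use fin in auto)
    also have "\<dots> \<le> one_step_ops (history V E \<sigma> \<omega> k)"
      by (rule card_distinguished_le_one_step_ops[OF fin one])
    also have "\<dots> \<le> q"
      using one_step_ops_le_worst_case_ops[of V E \<sigma> \<omega> k] enat by simp
    finally have "card {i \<in> I. \<omega> \<in> H i} \<le> q" .
    moreover have "(\<Sum>i\<in>I. indicator (G \<inter> H i) \<omega>) = real (card {i \<in> I. \<omega> \<in> H i})"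
      using True fin by (simp add: indicator_def Int_def)
    ultimately show ?thesis by simp
  next
    case False
    then show ?thesis by (simp add: indicator_def)
  qed
  have integrable: "integrable coin_space (indicator (G \<inter> H i) :: _ \<Rightarrow> real)" if "i \<in> I" for i
    using events[OF that] by (simp add: emeasure_eq_measure)
  have "1/3 * real (card I) = (\<Sum>i\<in>I. 1/3)"
    by simp
  also have "\<dots> \<le> (\<Sum>i\<in>I. prob (G \<inter> H i))"
    by (rule sum_mono) (rule ge)
  also have "\<dots> = expectation (\<lambda>\<omega>. \<Sum>i\<in>I. indicator (G \<inter> H i) \<omega>)"
    using integrable by (subst Bochner_Integration.integral_sum) auto
  also have "\<dots> \<le> expectation (\<lambda>\<omega>. real q)"
    using integrable pointwise by (intro integral_mono) auto
  also have "\<dots> = real q"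
    using prob_space by simp
  finally show ?thesis using enat by simp
qed

section \<open>The line graph and its cuts\<close>

definition line_graph :: "nat \<Rightarrow> (nat \<times> nat) set" where
  "line_graph n = {(a, b). a \<le> n \<and> b \<le> n \<and> b \<le> Suc a}"

definition cut_line_graph :: "nat \<Rightarrow> nat \<Rightarrow> (nat \<times> nat) set" where
  "cut_line_graph n i = line_graph n - {(i, Suc i)}"

lemma reach_input_line_graph: "reach_input {..n} (line_graph n) 0 {n}"
  by (auto simp: reach_input_def line_graph_def)

lemma reach_input_cut_line_graph: "reach_input {..n} (cut_line_graph n i) 0 {n}"
  by (auto simp: reach_input_def line_graph_def cut_line_graph_def)

lemma reachability_line_graph: "reachability (line_graph n) 0 {n}"
  unfolding reachability_def
proof (intro exI conjI)
  \<comment> \<open>The path has to be infinite: after reaching \<open>n\<close> it stays on the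
    self-loop there.\<close>
  show "infinite_path (line_graph n) (\<lambda>j. min j n)"
    by (auto simp: infinite_path_def line_graph_def min_def)
  show "min n n \<in> {n}" by simp
qed simp

lemma not_reachability_cut_line_graph:
  assumes "i < n"
  shows "\<not> reachability (cut_line_graph n i) 0 {n}"
proof
  assume "reachability (cut_line_graph n i) 0 {n}"
  then obtain p j where p: "infinite_path (cut_line_graph n i) p" "p 0 = 0" and j: "p j = n"
    by (auto simp: reachability_def)
  \<comment> \<open>The deleted edge is the only one of the line graph that leaves
    \<open>{..i}\<close>.\<close>
  have "p k \<le> i" for k
  proof (induction k)
    case (Suc k)
    have "(p k, p (Suc k)) \<in> cut_line_graph n i"
      using p(1) by (simp add: infinite_path_def)
    then show ?case
      using Suc by (auto simp: cut_line_graph_def line_graph_def)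
  qed (simp add: p)
  then show False using assms j by (metis not_le)
qed

section \<open>Distances and diameter\<close>

text \<open>Each step climbs by at most one but may stay or drop to any vertex, so only an upper
  bound on \<open>v\<close> remains. The power for \<open>k = 0\<close> is the identity, hence
  \<open>0 < k\<close>.\<close>

lemma relpow_line_graph_iff:
  assumes "u \<le> n" "v \<le> n" "0 < k"
  shows "(u, v) \<in> line_graph n ^^ k \<longleftrightarrow> v \<le> u + k"
  using assms(3,2)
proof (induction k arbitrary: v rule: nat_induct_non_zero)
  case 1
  then show ?case using assms by (auto simp: line_graph_def)
next
  case (Suc k)
  show ?case
  proof
    assume "(u, v) \<in> line_graph n ^^ Suc k"
    then obtain w where "(u, w) \<in> line_graph n ^^ k" "(w, v) \<in> line_graph n" by auto
    then show "v \<le> u + Suc k"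
      using Suc.IH[of w] by (auto simp: line_graph_def)
  next
    assume "v \<le> u + Suc k"
    \<comment> \<open>For \<open>v = 0\<close> truncated subtraction gives \<open>v - 1 = 0\<close>,
      and the last step is the self-loop at \<open>0\<close>.\<close>
    then have "(u, v - 1) \<in> line_graph n ^^ k" "(v - 1, v) \<in> line_graph n"
      using Suc.IH[of "v - 1"] Suc.prems by (auto simp: line_graph_def)
    then show "(u, v) \<in> line_graph n ^^ Suc k" by auto
  qed
qed

lemma relpow_line_graph:
  assumes "u \<le> n" "v \<le> n"
  shows "(u, v) \<in> line_graph n ^^ n"
  using assms relpow_line_graph_iff[OF assms, of n] by (cases "n = 0") auto

lemma distance_line_graph_le:
  assumes "u \<le> n" "v \<le> n"
  shows "distance (line_graph n) u v \<le> n"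
  unfolding distance_def by (intro Least_le relpow_line_graph assms)

lemma distance_line_graph_ends: "distance (line_graph n) 0 n = n"
  unfolding distance_def
proof (rule Least_equality)
  show "(0, n) \<in> line_graph n ^^ n" by (rule relpow_line_graph) auto
  show "n \<le> k" if "(0, n) \<in> line_graph n ^^ k" for k
    using that relpow_line_graph_iff[of 0 n n k] by (cases "k = 0") auto
qed

lemma graph_diameter_line_graph: "graph_diameter {..n} (line_graph n) = n"
  unfolding graph_diameter_def
proof (rule Max_eqI)
  let ?D = "{distance (line_graph n) u v |u v. u \<in> {..n} \<and> v \<in> {..n} \<and> (u, v) \<in> (line_graph n)\<^sup>*}"
  show le: "d \<le> n" if "d \<in> ?D" for d
    using that distance_line_graph_le by auto
  then show "finite ?D"
    by (meson finite_nat_set_iff_bounded_le)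
  have "(0, n) \<in> (line_graph n)\<^sup>*"
    using relpow_line_graph[of 0 n n] relpow_imp_rtrancl by auto
  then show "n \<in> ?D"
    using distance_line_graph_ends by (intro CollectI exI[of _ 0] exI[of _ n]) auto
qed

section \<open>What one operation reveals about the cut\<close>

text \<open>The answer changes only if \<open>i\<close> loses its sole successor in
  \<open>S\<close>. An element \<open>u \<le> i\<close> of \<open>S\<close> would remain a successor
  through the edge \<open>(i, u)\<close>.\<close>

lemma pre_set_cut_line_graph_neq:
  assumes "pre_set {..n} (line_graph n) S \<noteq> pre_set {..n} (cut_line_graph n i) S"
  shows "Suc i = (LEAST x. x \<in> S)"
proof -
  obtain v t where vt: "t \<in> S" "(v, t) \<in> line_graph n"
    and none: "\<forall>t\<in>S. (v, t) \<notin> cut_line_graph n i"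
    using assms unfolding pre_set_def cut_line_graph_def by blast
  have [simp]: "v = i" "t = Suc i"
    using vt none by (auto simp: cut_line_graph_def)
  have "Suc i \<le> u" if "u \<in> S" for u
  proof (rule ccontr)
    assume "\<not> Suc i \<le> u"
    then have "(i, u) \<in> cut_line_graph n i"
      using vt by (simp add: line_graph_def cut_line_graph_def)
    then show False using none that by simp
  qed
  then show ?thesis using vt by (intro Least_equality[symmetric]) auto
qed

text \<open>Dually, \<open>Suc i\<close> loses its sole predecessor in \<open>S\<close>, whereas any
  larger vertex in \<open>S\<close> would remain one. The bound \<open>x \<le> n\<close> excludes
  elements of \<open>S\<close> outside the graph, which could spoil the maximum.\<close>

lemma post_set_cut_line_graph_neq:
  assumes "post_set {..n} (line_graph n) S \<noteq> post_set {..n} (cut_line_graph n i) S"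
  shows "i = (GREATEST x. x \<in> S \<and> x \<le> n)"
proof -
  obtain v t where vt: "t \<in> S" "(t, v) \<in> line_graph n"
    and none: "\<forall>t\<in>S. (t, v) \<notin> cut_line_graph n i"
    using assms unfolding post_set_def cut_line_graph_def by blast
  have [simp]: "v = Suc i" "t = i"
    using vt none by (auto simp: cut_line_graph_def)
  have le: "i \<le> n"
    using vt by (simp add: line_graph_def)
  have "u \<le> i" if "u \<in> S" "u \<le> n" for u
  proof (rule ccontr)
    assume "\<not> u \<le> i"
    then have "(u, Suc i) \<in> cut_line_graph n i"
      using vt that by (simp add: line_graph_def cut_line_graph_def)
    then show False using none that by simp
  qed
  then show ?thesis using vt le by (intro Greatest_equality[symmetric]) auto
qed

text \<open>Minimum and maximum depend on \<open>S\<close> alone, so two cuts distinguished by the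
  same action coincide.\<close>

lemma card_distinguished_cut_line_graph:
  "card {i \<in> {..<n}. distinguishes {..n} (line_graph n) (cut_line_graph n i) a} \<le> 1"
proof -
  have "i = j" if "distinguishes {..n} (line_graph n) (cut_line_graph n i) a"
    "distinguishes {..n} (line_graph n) (cut_line_graph n j) a" for i j
  proof (cases a)
    case (Apply_Pre S)
    then have "Suc i = (LEAST x. x \<in> S)" "Suc j = (LEAST x. x \<in> S)"
      using that by (auto intro!: pre_set_cut_line_graph_neq)
    then show ?thesis by (simp only: nat.inject)
  next
    case (Apply_Post S)
    then have "i = (GREATEST x. x \<in> S \<and> x \<le> n)" "j = (GREATEST x. x \<in> S \<and> x \<le> n)"
      using that by (auto intro!: post_set_cut_line_graph_neq)
    then show ?thesis by (simp only:)
  qed (use that in auto)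
  then show ?thesis
    by (auto simp: card_le_Suc0_iff_eq)
qed

theorem theorem3p8:
  "\<exists>c::real. c > 0 \<and>
    (\<forall>A :: nat symbolic_algorithm.
      (deterministic A \<and> solves_reachability A) \<or> solves_reachability_bounded_error A \<longrightarrow>
      (\<forall>D\<^sub>0. \<exists>V E s T. reach_input V E s T \<and> graph_diameter V E \<ge> D\<^sub>0 \<and>
        ereal (c * real (graph_diameter V E)) \<le> ereal_of_enat (worst_case_ops V E (A V s T))))"
\<comment> \<open>The constant is \<open>2/3 + 2/3 - 1\<close>, the least probability that the
  answers on the full graph and on a given cut are both correct.\<close>
proof (intro exI[of _ "1/3"] conjI allI impI)
  fix A :: "nat symbolic_algorithm" and n
  assume "(deterministic A \<and> solves_reachability A) \<or> solves_reachability_bounded_error A"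
  then have A: "solves_reachability_bounded_error A"
    using solves_imp_solves_bounded_error by blast
  \<comment> \<open>The full graph and all its cuts share vertex set, start and target, so one
    strategy runs on all of them.\<close>
  let ?\<sigma> = "A {..n} 0 {n}"
  have ok: "\<P>(\<omega> in coin_space. outputs {..n} (line_graph n) ?\<sigma> \<omega> True) \<ge> 2/3"
    using A[unfolded solves_reachability_bounded_error_def, rule_format, OF reach_input_line_graph]
    by (simp only: reachability_line_graph)
  have ok_cut: "\<P>(\<omega> in coin_space. outputs {..n} (cut_line_graph n i) ?\<sigma> \<omega> (\<not> True)) \<ge> 2/3"
    if "i \<in> {..<n}" for i
    using A[unfolded solves_reachability_bounded_error_def, rule_format,
        OF reach_input_cut_line_graph[of n i]]
      not_reachability_cut_line_graph[of i n] that
    by (simp only: lessThan_iff simp_thms)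
  have "ereal (1/3 * real (card {..<n})) \<le> ereal_of_enat (worst_case_ops {..n} (line_graph n) ?\<sigma>)"
    using finite_lessThan card_distinguished_cut_line_graph ok ok_cut
    by (rule card_indistinguishable_le_worst_case_ops)
  then show "\<exists>V E s T. reach_input V E s T \<and> graph_diameter V E \<ge> n \<and>
      ereal (1/3 * real (graph_diameter V E)) \<le> ereal_of_enat (worst_case_ops V E (A V s T))"
    by (intro exI[of _ "{..n}"] exI[of _ "line_graph n"] exI[of _ 0] exI[of _ "{n}"])
      (simp add: reach_input_line_graph graph_diameter_line_graph)
qed simp

end
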